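(* Let $S$ be an intermediate Kato surface with $N\ge1$ branches and Dloussky sequence $[\mathrm{Dl}S_1\cdots \mathrm{Dl}S_N]$, where $\mathrm{Dl}S_f=[s_{k_{0f}}s_{k_{1f}}\cdots s_{k_{(p_f-1)f}}r_{m_f}]$ for $f=1,\dots,N$. Put $\mathcal P_f=\mathcal P(k_{0f},k_{1f},\dots,k_{(p_f-1)f})$ and $\mathcal Q_f=\mathcal P(k_{1f},\dots,k_{(p_f-1)f})+m_f$. Then $$\mathrm{index}(S)=\frac{\prod_{f=1}^N(\mathcal P_f+1)-1}{\gcd\Big\{\prod_{f=1}^N(\mathcal P_f+1)-1,\ \ \sum_{h=1}^N\Big[\mathcal Q_h\prod_{f=h+1}^N(\mathcal P_f+1)\Big]\Big\}}.$$
   Context: A Kato surface is a minimal compact complex surface $S$ with $b:=b_2(S)>0$ containing a global spherical shell (an open subset $V$ biholomorphic to a neighbourhood of $S^3\subset\mathbb C^2$ with $S\setminus V$ connected). It contains exactly $b$ rational curves. $S$ is intermediate if its maximal curve $D$ (the sum of these $b$ curves) is connected and consists of one cycle of rational curves together with $N\ge1$ branches. Then the $b$ curves $D_i$ form a basis of $H^2(S,\mathbb Q)$; the first Chern class of $S$ is denoted $-K$, and $-K=\sum d_iD_i$ with unique $d_i\in\mathbb Q$. The index of $S$ is the least positive integer $n$ such that $-nK$ is represented by an effective divisor, i.e. $nd_i\in\mathbb Z_{\ge 0}$ for all $i$. Dloussky sequence: listing the curves in their order of creation (cyclically) gives a sequence of integers $\ge 2$, the opposite self-intersection numbers of the curves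 (if a curve is nodal, which happens only when the cycle is irreducible, its entry $e$ satisfies $D_i^2=-e+2$). The dual graph has, for each entry with value $e$, one edge joining that curve to the curve $e-1$ places after it in cyclic order. Put $s_k=(k+2,2,\dots,2)$ (length $k\ge1$) and $r_m=(2,\dots,2)$ (length $m\ge1$). An intermediate Kato surface with $N$ branches has, up to cyclic permutation, a Dloussky sequence which is a concatenation $[\mathrm{Dl}S_1\cdots\mathrm{Dl}S_N]$ of simple sequences $\mathrm{Dl}S_f=[s_{k_{0f}}\cdots s_{k_{(p_f-1)f}}r_{m_f}]$ with $p_f\ge1$, all $k_{if}\ge1$, $m_f\ge1$. Polynomials: $f(X_1)=X_1$, $f(X_1,X_2)=X_1X_2+1$, $f(X_1,\dots,X_n)=X_nf(X_1,\dots,X_{n-1})+f(X_1,\dots,X_{n-2})$; $\mathcal P(X_1)=X_1$, $\mathcal P(X_1,X_2)=X_1X_2+X_1$, $\mathcal P(X_1,\dots,X_n)=X_nf(X_1,\dots,X_{n-1})+\mathcal P(X_1,\dots,X_{n-1})$; by convention $\mathcal P$ of the empty list is $0$. An empty product is $1$. *)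

theory Defs
  imports Complex_Main
begin

(* A Dloussky sequence is a nat list; the curves are numbered 0..<length e in their cyclic
   order of creation, so "k places after" is addition modulo length e. *)

definition s_seq :: "nat \<Rightarrow> nat list" where
  "s_seq k = (k + 2) # replicate (k - 1) 2"

definition r_seq :: "nat \<Rightarrow> nat list" where
  "r_seq m = replicate m 2"

definition simple_seq :: "(nat \<Rightarrow> nat) \<Rightarrow> nat \<Rightarrow> nat \<Rightarrow> nat list" where
  "simple_seq k p m = concat (map (\<lambda>i. s_seq (k i)) [0..<p]) @ r_seq m"

definition dloussky_seq ::
  "nat \<Rightarrow> (nat \<Rightarrow> nat) \<Rightarrow> (nat \<Rightarrow> nat \<Rightarrow> nat) \<Rightarrow> (nat \<Rightarrow> nat) \<Rightarrow> nat list" where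
  "dloussky_seq N p k m = concat (map (\<lambda>f. simple_seq (k f) (p f) (m f)) [1..<Suc N])"

definition edge_target :: "nat list \<Rightarrow> nat \<Rightarrow> nat" where
  "edge_target e i = (i + (e ! i - 1)) mod length e"

(* Number of edges between two distinct vertices; it can be 2, for a cycle of two curves. *)
definition edges :: "nat list \<Rightarrow> nat \<Rightarrow> nat \<Rightarrow> nat" where
  "edges e i j = of_bool (edge_target e i = j) + of_bool (edge_target e j = i)"

(* A loop of the dual graph is a node of the curve. *)
definition nodal :: "nat list \<Rightarrow> nat \<Rightarrow> bool" where
  "nodal e i \<longleftrightarrow> edge_target e i = i"

definition self_int :: "nat list \<Rightarrow> nat \<Rightarrow> int" where
  "self_int e i = (if nodal e i then - int (e ! i) + 2 else - int (e ! i))"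

(* A rational curve has arithmetic genus 0 if it is smooth and 1 if it has a single node. *)
definition arith_genus :: "nat list \<Rightarrow> nat \<Rightarrow> int" where
  "arith_genus e i = (if nodal e i then 1 else 0)"

(* Complex surfaces are not available, so a surface enters through its second cohomology:
   'h with scale is H^2(S,Q), ip is the intersection form (nondegenerate by Poincare duality),
   K is the canonical class, so that -K is the first Chern class, and D i, i < length e, are the
   classes of the rational curves. Their intersection numbers are those prescribed by the
   Dloussky sequence e, and K is constrained by the genus formula K.C + C^2 = 2 p_a(C) - 2. *)
locale kato_cohomology = vector_space scale
  for scale :: "rat \<Rightarrow> 'h::ab_group_add \<Rightarrow> 'h" +
  fixes ip :: "'h \<Rightarrow> 'h \<Rightarrow> rat"
    and K :: 'h
    and D :: "nat \<Rightarrow> 'h"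
    and e :: "nat list"
  assumes ip_sym: "ip x y = ip y x"
    and ip_add: "ip (x + y) z = ip x z + ip y z"
    and ip_scale: "ip (scale c x) z = c * ip x z"
    and ip_nondegenerate: "(\<And>y. ip x y = 0) \<Longrightarrow> x = 0"
    and curves_inj: "inj_on D {..<length e}"
    and curves_independent: "independent (D ` {..<length e})"
    and curves_span: "span (D ` {..<length e}) = UNIV"
    and entries_ge_2: "\<forall>a\<in>set e. a \<ge> 2"
    and curve_self_int: "i < length e \<Longrightarrow> ip (D i) (D i) = of_int (self_int e i)"
    and curve_int: "i < length e \<Longrightarrow> j < length e \<Longrightarrow> i \<noteq> j \<Longrightarrow>
          ip (D i) (D j) = of_nat (edges e i j)"
    and adjunction: "i < length e \<Longrightarrow>
          ip K (D i) + ip (D i) (D i) = of_int (2 * arith_genus e i - 2)"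

(* Effective divisors are supported on the curves D 0, ..., D (b - 1). *)
definition surface_index ::
  "(rat \<Rightarrow> 'h::ab_group_add \<Rightarrow> 'h) \<Rightarrow> 'h \<Rightarrow> (nat \<Rightarrow> 'h) \<Rightarrow> nat \<Rightarrow> nat" where
  "surface_index scale K D b =
     (LEAST n. n > 0 \<and> (\<exists>a :: nat \<Rightarrow> nat.
        scale (of_nat n) (- K) = (\<Sum>i<b. scale (of_nat (a i)) (D i))))"

(* poly_f X n is f(X 0, ..., X (n-1)) and poly_P X n is P(X 0, ..., X (n-1)). Setting f = 1 on
   the empty list makes the recursion also give f(X_1,X_2) = X_1 X_2 + 1, P(X_1) = X_1 and
   P(X_1,X_2) = X_1 X_2 + X_1. *)
fun poly_f :: "(nat \<Rightarrow> nat) \<Rightarrow> nat \<Rightarrow> nat" where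
  "poly_f X 0 = 1"
| "poly_f X (Suc 0) = X 0"
| "poly_f X (Suc (Suc n)) = X (Suc n) * poly_f X (Suc n) + poly_f X n"

fun poly_P :: "(nat \<Rightarrow> nat) \<Rightarrow> nat \<Rightarrow> nat" where
  "poly_P X 0 = 0"
| "poly_P X (Suc n) = X n * poly_f X n + poly_P X n"

end

theory Submission
  imports Defs
begin

text \<open>
  Since \<open>D_i\<^sup>2\<close> is \<open>- e_i\<close> plus twice the number of loops at \<open>i\<close>, nodal and smooth curves
  obey the same formulas, and the genus formula turns \<open>- K = \<Sum> d_i D_i\<close> into one square system:
  \<open>- e_i d_i\<close>, plus the coefficient at the end of the edge leaving \<open>i\<close>, plus the coefficients at
  the starts of the edges entering \<open>i\<close>, equals \<open>2 - e_i\<close>. The intersection form is nondegenerate and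
  the curves form a basis, so any solution gives the coordinates \<open>d_i\<close>
  (\<open>anticanonical_coordinates\<close>).

  A solution can be written down by walking once around the Dloussky sequence, one block
  \<open>s_k\<close> or \<open>r_m\<close> at a time. What guides the walk is the picture
  \<open>D_i = E_i - E_(i+1) - ... - E_(i+e_i-1)\<close>, \<open>K = \<Sum> E_j\<close> with orthogonal classes of square
  \<open>-1\<close>, in which the system becomes the recursion
  \<open>d_j + 1 = \<Sum> {d_i | j is one of the e_i - 1 places after i}\<close>. At the first curve of a block only
  two numbers matter: \<open>x\<close>, its coefficient minus one, and \<open>y\<close>, which is the same quantity at the
  first curve of the preceding block if that block is an \<open>s_k\<close>, and \<open>-1\<close> otherwise. The block
  \<open>s_k\<close> acts by \<open>(x, y) \<mapsto> (k x + y, x)\<close>, the step of the continuant recursion for \<open>f\<close>, and \<open>r_m\<close>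
  resets \<open>y\<close> to \<open>-1\<close>. The walk closes up, hence solves the system (\<open>coeffs_solve\<close>), when \<open>x\<close>
  returns to its initial value. A simple sequence acts on \<open>x\<close> by
  \<open>x \<mapsto> (P_f + 1) x - Q_f\<close> (\<open>fold_simple_blocks\<close>), because \<open>P + 1\<close> is the sum of two consecutive
  continuants; composing over all branches gives the fixed point
  \<open>x = (\<Sum>_h Q_h \<Prod>_(f>h) (P_f + 1)) / (\<Prod>_f (P_f + 1) - 1)\<close>.

  All coefficients are integral affine combinations of \<open>1\<close> and \<open>x\<close>, and one of them is \<open>x + 1\<close>, so
  \<open>n d_i\<close> is integral for all \<open>i\<close> exactly if \<open>n x\<close> is (\<open>coeffs_integral\<close>). They are also
  nonnegative (\<open>coeffs_nonneg\<close>). Thus the index is the reduced denominator of \<open>x\<close>.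
\<close>

section \<open>Blocks\<close>

datatype block = Singular nat | Regular nat

fun block_size :: "block \<Rightarrow> nat" where
  "block_size (Singular k) = k"
| "block_size (Regular m) = m"

fun block_entry :: "block \<Rightarrow> nat \<Rightarrow> nat" where
  "block_entry (Singular k) l = (if l = 0 then k + 2 else 2)"
| "block_entry (Regular m) l = 2"

definition block_word :: "block \<Rightarrow> nat list" where
  "block_word B = map (block_entry B) [0..<block_size B]"

definition word :: "block list \<Rightarrow> nat list" where
  "word bl = concat (map block_word bl)"

definition proper :: "block list \<Rightarrow> bool" where
  "proper bl \<longleftrightarrow> (\<forall>B\<in>set bl. block_size B \<ge> 1)"

text \<open>
  A state \<open>(x, y)\<close> describes the first curve of a block: its coefficient in \<open>- K\<close> is \<open>x + 1\<close>, and
  \<open>y + 1\<close> is the coefficient of the first curve of the preceding block if that block is singular, and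
  \<open>0\<close> if it is regular. So \<open>y + 1\<close> is the total coefficient of the curves before the block whose
  edge ends at the position right after the first curve of the block.
\<close>
fun next_state :: "block \<Rightarrow> rat \<times> rat \<Rightarrow> rat \<times> rat" where
  "next_state (Singular k) (x, y) = (of_nat k * x + y, x)"
| "next_state (Regular m) (x, y) = (x + y + 1 - of_nat m, -1)"

text \<open>
  Only offset \<open>0\<close> is exceptional. The other formulas remain right at the offset \<open>block_size B\<close>,
  where they give the coefficient of the first curve of the next block.
\<close>
fun block_coeff :: "block \<Rightarrow> rat \<times> rat \<Rightarrow> nat \<Rightarrow> rat" where
  "block_coeff (Singular k) (x, y) l = (if l = 0 then x + 1 else of_nat l * x + y + 1)"
| "block_coeff (Regular m) (x, y) l = (if l = 0 then x + 1 else x + y + 2 - of_nat l)"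

text \<open>
  The list is one longer than the word: the extra last entry is the coefficient that the walk
  predicts for the curve at which it started.
\<close>
fun coeffs :: "block list \<Rightarrow> rat \<times> rat \<Rightarrow> rat list" where
  "coeffs [] s = [fst s + 1]"
| "coeffs (B # bl) s = map (block_coeff B s) [0..<block_size B] @ coeffs bl (next_state B s)"

lemma length_block_word [simp]: "length (block_word B) = block_size B"
  by (simp add: block_word_def)

lemma word_simps [simp]:
  "word [] = []" "word (B # bl) = block_word B @ word bl" "word (us @ vs) = word us @ word vs"
  by (simp_all add: word_def)

lemma proper_simps [simp]:
  "proper []" "proper (B # bl) \<longleftrightarrow> block_size B \<ge> 1 \<and> proper bl"
  "proper (us @ vs) \<longleftrightarrow> proper us \<and> proper vs"
  by (auto simp: proper_def)

lemma nth_word: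
  assumes "l < block_size B"
  shows "word (us @ B # vs) ! (length (word us) + l) = block_entry B l"
  using assms by (simp add: nth_append block_word_def)

lemma obtain_block:
  assumes "i < length (word bl)"
  obtains us B vs l where "bl = us @ B # vs" "i = length (word us) + l" "l < block_size B"
proof -
  have "\<exists>us B vs l. bl = us @ B # vs \<and> i = length (word us) + l \<and> l < block_size B"
    using assms
  proof (induction bl arbitrary: i)
    case (Cons B bl)
    show ?case
    proof (cases "i < block_size B")
      case True
      then show ?thesis by (intro exI[of _ "[]"]) auto
    next
      case False
      then have "i - block_size B < length (word bl)" using Cons.prems by auto
      from Cons.IH[OF this] obtain us C vs l where
        "bl = us @ C # vs" "i - block_size B = length (word us) + l" "l < block_size C" by blast
      then show ?thesis using False
        by (intro exI[of _ "B # us"] exI[of _ C] exI[of _ vs] exI[of _ l]) auto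
    qed
  qed simp
  then show thesis using that by blast
qed

lemma coeffs_append:
  "coeffs (us @ vs) s =
     take (length (word us)) (coeffs us s) @ coeffs vs (fold next_state us s)"
  "length (coeffs us s) = Suc (length (word us))"
  by (induction us arbitrary: s) auto

lemma nth_coeffs_append:
  "coeffs (us @ vs) s ! (length (word us) + l) = coeffs vs (fold next_state us s) ! l"
  by (simp add: coeffs_append nth_append)

lemma hd_coeffs: "proper bl \<Longrightarrow> coeffs bl s ! 0 = fst s + 1"
  by (cases bl; cases s; cases "hd bl") (auto simp: nth_append)

lemma block_coeff_end:
  "block_size B \<ge> 1 \<Longrightarrow> block_coeff B s (block_size B) = fst (next_state B s) + 1"
  by (cases B; cases s) auto

lemma nth_coeffs:
  assumes "proper (us @ B # vs)" "l \<le> block_size B"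
  shows "coeffs (us @ B # vs) s ! (length (word us) + l) = block_coeff B (fold next_state us s) l"
proof (cases "l < block_size B")
  case True
  then show ?thesis by (simp add: nth_coeffs_append nth_append)
next
  case False
  then have "l = block_size B" using assms by simp
  then show ?thesis using assms
    by (simp add: nth_coeffs_append nth_append hd_coeffs block_coeff_end)
qed

section \<open>The linear system\<close>

text \<open>
  Positions are not reduced modulo the length here, and only the first \<open>c\<close> curves are counted, so that
  the sum can be computed by induction on a prefix of the block list.
\<close>
definition arrivals :: "block list \<Rightarrow> rat \<times> rat \<Rightarrow> nat \<Rightarrow> nat \<Rightarrow> rat" where
  "arrivals bl s c i =
     (\<Sum>j<c. of_bool (j + (word bl ! j - 1) = i) * coeffs bl s ! j)"

text \<open>
  The sum of the coefficients entering the \<open>i\<close>-th position, \<open>i \<ge> 1\<close>, after the start of a block,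
  from inside the block and from before it. An entry \<open>2\<close> points to the next position. The first curve
  of \<open>s_k\<close> points to position \<open>k + 1\<close>, one past the start of the next block.
\<close>
fun arrival_coeff :: "block \<Rightarrow> rat \<times> rat \<Rightarrow> nat \<Rightarrow> rat" where
  "arrival_coeff (Singular k) (x, y) i =
     (if i \<le> k then (of_nat i - 1) * x + y + 1 else if i = k + 1 then x + 1 else 0)"
| "arrival_coeff (Regular m) (x, y) i = (if i \<le> m then x + y + 3 - of_nat i else 0)"

text \<open>
  The first summand is what earlier blocks contribute: they reach no further than position \<open>1\<close> of this
  block, and there they contribute \<open>y + 1\<close>. With it, position \<open>1\<close> fits the formula of the other
  positions.
\<close>
lemma block_arrivals:
  assumes "block_size B \<ge> 1" "i \<ge> 1"
  shows "of_bool (i = 1) * (snd s + 1)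
         + (\<Sum>l<block_size B. of_bool (l + (block_entry B l - 1) = i) * block_coeff B s l)
         = arrival_coeff B s i"
proof -
  obtain x y where s: "s = (x, y)" by force
  define q where "q = block_size B"
  have split: "{..<q} = insert 0 {1..<q}" using assms by (auto simp: q_def)
  have delta: "(\<Sum>l\<in>{1..<q}. of_bool (Suc l = i) * g l)
      = (if 2 \<le> i \<and> i \<le> q then g (i - 1) else 0)" for g :: "nat \<Rightarrow> rat"
  proof -
    have "(\<Sum>l\<in>{1..<q}. of_bool (Suc l = i) * g l)
       = (\<Sum>l\<in>{1..<q}. if l = i - 1 then g l else 0)"
      using assms by (intro sum.cong) auto
    also have "\<dots> = (if 2 \<le> i \<and> i \<le> q then g (i - 1) else 0)" by auto
    finally show ?thesis .
  qed
  have "(\<Sum>l<q. of_bool (l + (block_entry B l - 1) = i) * block_coeff B s l)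
     = of_bool (block_entry B 0 - 1 = i) * block_coeff B s 0
       + (\<Sum>l\<in>{1..<q}. of_bool (l + (block_entry B l - 1) = i) * block_coeff B s l)"
    by (simp add: split)
  also have "(\<Sum>l\<in>{1..<q}. of_bool (l + (block_entry B l - 1) = i) * block_coeff B s l)
     = (\<Sum>l\<in>{1..<q}. of_bool (Suc l = i) * block_coeff B s l)"
    by (intro sum.cong) (cases B; auto)+
  finally show ?thesis
    using assms unfolding delta q_def[symmetric]
    by (cases B) (auto simp: s q_def of_nat_diff algebra_simps split: if_splits)
qed

lemma arrivals_block:
  assumes "proper (us @ B # vs)" "i \<ge> 1"
    and "arrivals (us @ B # vs) s (length (word us)) (length (word us) + i)
         = of_bool (i = 1) * (snd (fold next_state us s) + 1)"
  shows "arrivals (us @ B # vs) s (length (word us) + block_size B) (length (word us) + i)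
         = arrival_coeff B (fold next_state us s) i"
proof -
  let ?c = "length (word us)" and ?bl = "us @ B # vs"
  define g where "g j = of_bool (j + (word ?bl ! j - 1) = ?c + i) * coeffs ?bl s ! j" for j
  have *: "(\<Sum>j<c + q. g j) = (\<Sum>j<c. g j) + (\<Sum>l<q. g (c + l))" for c q
    by (induction q) (auto simp: add.assoc)
  have "(\<Sum>l<block_size B. g (?c + l))
      = (\<Sum>l<block_size B. of_bool (l + (block_entry B l - 1) = i)
                            * block_coeff B (fold next_state us s) l)"
  proof (intro sum.cong refl)
    fix l assume "l \<in> {..<block_size B}"
    then show "g (?c + l) = of_bool (l + (block_entry B l - 1) = i)
                            * block_coeff B (fold next_state us s) l"
      unfolding g_def using assms(1) by (subst nth_word, simp, subst nth_coeffs, auto)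
  qed
  then show ?thesis
    using assms * block_arrivals[of B i "fold next_state us s"]
    by (simp add: arrivals_def g_def)
qed

text \<open>
  The values at the end of a prefix depend on its final state alone, whichever kind of block comes
  last and however short it is. The empty prefix differs only at \<open>i = 0\<close>: the edges entering the first
  curve come around from the end of the word.
\<close>
lemma arrivals_prefix:
  assumes "proper (us @ vs)"
  shows "arrivals (us @ vs) (x, -1) (length (word us)) (length (word us) + i)
    = (let (x', y') = fold next_state us (x, -1) in
       if i = 0 then of_bool (us \<noteq> []) * (x' - y' + 1) else if i = 1 then y' + 1 else 0)"
  using assms
proof (induction us arbitrary: vs i rule: rev_induct)
  case Nil
  then show ?case by (simp add: arrivals_def)
next
  case (snoc B us)
  obtain x' y' where s: "fold next_state us (x, -1) = (x', y')" by force
  have *: "arrivals (us @ B # vs) (x, -1) (length (word us)) (length (word us) + j)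
     = of_bool (j = 1) * (snd (fold next_state us (x, -1)) + 1)" if "j \<ge> 1" for j
    using snoc.IH[of "B # vs" j] snoc.prems that by (auto simp: s)
  have "arrivals (us @ B # vs) (x, -1) (length (word us) + block_size B)
          (length (word us) + (block_size B + i)) = arrival_coeff B (x', y') (block_size B + i)"
    using arrivals_block[of us B vs "block_size B + i" "(x, -1)"] * snoc.prems s by auto
  then show ?case using snoc.prems
    by (cases B) (auto simp: s add.assoc algebra_simps)
qed

lemma entry_ge_2: "i < length (word bl) \<Longrightarrow> word bl ! i \<ge> 2"
proof (elim obtain_block)
  fix us B vs l assume "bl = us @ B # vs" "i = length (word us) + l" "l < block_size B"
  then show "word bl ! i \<ge> 2" by (cases B) (simp_all del: word_simps add: nth_word)
qed

text \<open>As entries are at least \<open>2\<close>, every edge leads strictly forward.\<close>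
lemma arrivals_mono_neutral:
  assumes "c \<le> length (word bl)" "i \<le> c"
  shows "arrivals bl s (length (word bl)) i = arrivals bl s c i"
  unfolding arrivals_def
proof (rule sum.mono_neutral_right)
  show "\<forall>j\<in>{..<length (word bl)} - {..<c}. of_bool (j + (word bl ! j - 1) = i) * coeffs bl s ! j = 0"
  proof
    fix j assume "j \<in> {..<length (word bl)} - {..<c}"
    then have "j \<ge> c" "word bl ! j \<ge> 2" using entry_ge_2 by auto
    then show "of_bool (j + (word bl ! j - 1) = i) * coeffs bl s ! j = 0" using assms by auto
  qed
qed (use assms in auto)

text \<open>
  A singular block reaches one position beyond the start of its successor, which lies in the word
  because the last block is regular. So the only edges that wrap around end at position \<open>0\<close>.
\<close>
lemma target_le_length:
  assumes "proper bl" "bl \<noteq> []" "last bl = Regular m" "i < length (word bl)"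
  shows "i + (word bl ! i - 1) \<le> length (word bl)"
  using assms(4)
proof (rule obtain_block)
  fix us B vs l assume *: "bl = us @ B # vs" "i = length (word us) + l" "l < block_size B"
  have e: "word bl ! i = block_entry B l"
    using * by (metis nth_word)
  have "vs \<noteq> []" if "B = Singular k" for k using assms * that by auto
  then have "length (word vs) \<ge> 1" if "B = Singular k" for k
    using assms * that by (cases vs) auto
  then show ?thesis using * e by (cases B) (fastforce simp: *)+
qed

text \<open>
  Inside a block the coefficients form an arithmetic progression, continued by the incoming
  sum on one side and by the next coefficient on the other, so its second differences vanish as the
  entries \<open>2\<close> require. At the first curve of a block the incoming sum is
  \<open>x - y + 1\<close>, and the outgoing edge reaches position \<open>1\<close> of a block, whose coefficient is the
  sum \<open>x + y + 1\<close> for the state there, independently of the kind of that block. At position \<open>0\<close>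
  the periodicity of the walk supplies the missing incoming edges.
\<close>
lemma coeffs_solve:
  fixes bl x
  defines "n \<equiv> length (word bl)" and "e \<equiv> word bl" and "d \<equiv> \<lambda>i. coeffs bl (x, -1) ! i"
  assumes proper: "proper bl" and last: "bl \<noteq> []" "last bl = Regular m"
    and periodic: "fst (fold next_state bl (x, -1)) = x"
    and i: "i < n"
  shows "- of_nat (e ! i) * d i + d (edge_target e i)
         + (\<Sum>j<n. of_bool (edge_target e j = i) * d j) = 2 - of_nat (e ! i)"
proof -
  obtain us B vs l where
    bl: "bl = us @ B # vs" and il: "i = length (word us) + l" and l: "l < block_size B"
    using obtain_block i unfolding n_def by metis
  obtain x' y' where s: "fold next_state us (x, -1) = (x', y')" by force
  let ?c = "length (word us)"
  have ei: "e ! i = block_entry B l" using bl il l e_def nth_word by metis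
  have dl: "d (?c + l') = block_coeff B (x', y') l'" if "l' \<le> block_size B" for l'
    unfolding d_def bl using nth_coeffs[of us B vs l' "(x, -1)"] that proper bl s by auto
  \<comment> \<open>The last block is regular, so \<open>y\<close> returns to \<open>-1\<close> by itself.\<close>
  have final: "fold next_state bl (x, -1) = (x, -1)"
  proof -
    have "fold next_state bl (x, -1)
        = next_state (Regular m) (fold next_state (butlast bl) (x, -1))"
      using last by (metis append_butlast_last_id fold_append fold_simps comp_apply)
    then have "snd (fold next_state bl (x, -1)) = -1"
      by (cases "fold next_state (butlast bl) (x, -1)") auto
    then show ?thesis using periodic by (metis prod.collapse)
  qed
  have wrap: "d n = d 0"
    using nth_coeffs_append[of bl "[]" "(x, -1)" 0] final hd_coeffs[OF proper]
    by (simp add: d_def n_def)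
  have bound: "j + (e ! j - 1) \<le> n" "e ! j \<ge> 2" if "j < n" for j
    using target_le_length[OF proper last] entry_ge_2 that unfolding e_def n_def by auto
  have target: "edge_target e j = (if j + (e ! j - 1) = n then 0 else j + (e ! j - 1))"
    if "j < n" for j
    using bound[OF that] unfolding edge_target_def by (simp add: n_def e_def)
  have out: "d (edge_target e i) = d (i + (e ! i - 1))" using target[OF i] wrap by simp
  have "(\<Sum>j<n. of_bool (edge_target e j = i) * d j)
      = arrivals bl (x, -1) n (if i = 0 then n else i)"
    unfolding arrivals_def d_def[symmetric] e_def[symmetric]
  proof (intro sum.cong refl)
    fix j assume "j \<in> {..<n}"
    then show "of_bool (edge_target e j = i) * d j
       = of_bool (j + (e ! j - 1) = (if i = 0 then n else i)) * d j"
      using target[of j] bound[of j] i by (auto simp: e_def)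
  qed
  also have "\<dots> = (if l = 0 then x' - y' + 1 else arrival_coeff B (x', y') l)"
  proof (cases "i = 0")
    case True
    then have "us = []" using il proper bl by (cases us) auto
    then show ?thesis using True il s last
      arrivals_prefix[of bl "[]" x 0] proper final by (auto simp: n_def)
  next
    case False
    show ?thesis
    proof (cases "l = 0")
      case True
      then have "us \<noteq> []" using il False by auto
      then show ?thesis
        using True il False arrivals_prefix[of us "B # vs" x 0] proper s bl
          arrivals_mono_neutral[of ?c bl ?c "(x, -1)"]
        by (auto simp: n_def)
    next
      case l0: False
      have "arrivals (us @ B # vs) (x, -1) (?c + block_size B) (?c + l) = arrival_coeff B (x', y') l"
        using arrivals_block[of us B vs l "(x, -1)"] arrivals_prefix[of us "B # vs" x l] proper s bl l0
        by auto
      then show ?thesis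
        using l0 False il arrivals_mono_neutral[of "?c + block_size B" bl i "(x, -1)"] l bl
        by (auto simp: n_def)
    qed
  qed
  finally have inc: "(\<Sum>j<n. of_bool (edge_target e j = i) * d j)
     = (if l = 0 then x' - y' + 1 else arrival_coeff B (x', y') l)" .
  show ?thesis
  proof (cases B)
    case (Regular m')
    then have "d (i + (e ! i - 1)) = block_coeff B (x', y') (Suc l)"
      using dl[of "Suc l"] l ei il by simp
    then show ?thesis using Regular ei dl[of l] l il out inc
      by (auto simp: algebra_simps)
  next
    case (Singular k)
    show ?thesis
    proof (cases "l = 0")
      case False
      then have "d (i + (e ! i - 1)) = block_coeff B (x', y') (Suc l)"
        using dl[of "Suc l"] l ei il Singular by simp
      then show ?thesis using Singular False ei dl[of l] l il out inc
        by (auto simp: algebra_simps)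
    next
      case True
      \<comment> \<open>The edge of the first curve of \<open>s_k\<close> ends at offset \<open>1\<close> of the following block.\<close>
      obtain C ws where vs: "vs = C # ws" using last bl Singular by (cases vs) auto
      have "d (i + (e ! i - 1)) = coeffs ((us @ [B]) @ C # ws) (x, -1) ! (length (word (us @ [B])) + 1)"
        using True ei il Singular by (simp add: d_def bl vs add.assoc)
      also have "\<dots> = block_coeff C (next_state B (x', y')) 1"
        using nth_coeffs[of "us @ [B]" C ws 1 "(x, -1)"] proper bl vs s by simp
      also have "\<dots> = (of_nat k + 1) * x' + y' + 1"
        by (cases C) (auto simp: Singular algebra_simps)
      finally show ?thesis using Singular True ei dl[of l] l il out inc
        by (auto simp: algebra_simps)
    qed
  qed
qed

section \<open>Effectivity and integrality\<close>

text \<open>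
  Once both components of the state are negative they stay so, which a walk returning to a
  nonnegative \<open>x\<close> cannot afford.
\<close>
lemma negative_state_persists:
  assumes "proper bl" "fst s < 0" "snd s < 0"
  shows "fst (fold next_state bl s) < 0"
  using assms
proof (induction bl arbitrary: s)
  case (Cons B bl)
  obtain x y where s: "s = (x, y)" by force
  have "fst (next_state B s) < 0 \<and> snd (next_state B s) < 0"
  proof (cases B)
    case (Singular k)
    then have "of_nat k * x \<le> 0" using Cons.prems s by (simp add: mult_nonneg_nonpos)
    then show ?thesis using Cons.prems s Singular by simp
  next
    case (Regular m)
    then have "(1::rat) \<le> of_nat m" using Cons.prems by simp
    then show ?thesis using Cons.prems s Regular by simp
  qed
  then show ?case using Cons by simp
qed simp

text \<open>
  Along the walk \<open>x\<close> may become negative, but not below \<open>-1\<close>: after a step \<open>k x + y < -1\<close> with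
  \<open>y \<ge> -1\<close> both \<open>x\<close> and the new first component would be negative. Within a block the
  coefficients after the first lie on a line (also when extended to offset \<open>0\<close> for \<open>s_k\<close>,
  where it has the value \<open>y + 1\<close>), so bounds at the ends suffice.
\<close>
lemma coeffs_nonneg:
  assumes "proper bl" "fst s \<ge> -1" "snd s \<ge> -1" "fst (fold next_state bl s) \<ge> 0"
    and "d \<in> set (coeffs bl s)"
  shows "d \<ge> 0"
  using assms
proof (induction bl arbitrary: s)
  case (Cons B bl)
  obtain x y where s: "s = (x, y)" by force
  have xy: "x \<ge> -1" "y \<ge> -1" using Cons.prems s by auto
  have alive: "\<not> (fst (next_state B s) < 0 \<and> snd (next_state B s) < 0)"
    using negative_state_persists[of bl "next_state B s"] Cons.prems by force
  have next_ge: "fst (next_state B s) \<ge> -1" "snd (next_state B s) \<ge> -1"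
  proof -
    have "fst (next_state B s) \<ge> -1 \<and> snd (next_state B s) \<ge> -1"
    proof (cases B)
      case (Singular k)
      show ?thesis
      proof (cases "x < 0")
        case True
        then show ?thesis using alive xy s Singular by auto
      next
        case False
        then have "of_nat k * x \<ge> 0" by simp
        then show ?thesis using xy s Singular by simp
      qed
    next
      case (Regular m)
      then show ?thesis using alive s by auto
    qed
    then show "fst (next_state B s) \<ge> -1" "snd (next_state B s) \<ge> -1" by auto
  qed
  have "block_coeff B s l \<ge> 0" if "l < block_size B" for l
  proof (cases B)
    case (Singular k)
    have "of_nat l * x + y + 1 \<ge> 0"
    proof (cases "x \<ge> 0")
      case True
      then have "of_nat l * x \<ge> 0" by simp
      then show ?thesis using xy by linarith
    next
      case False
      then have "of_nat l * x \<ge> of_nat k * x"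
        using that Singular by (intro mult_right_mono_neg) auto
      then show ?thesis using next_ge s Singular by simp
    qed
    then show ?thesis using xy s Singular by simp
  next
    case (Regular m)
    then have "(of_nat l :: rat) \<le> of_nat m" using that by simp
    then show ?thesis using next_ge xy s Regular by auto
  qed
  then show ?case using Cons next_ge by fastforce
qed simp

lemma coeffs_integral:
  assumes "of_nat n * fst s \<in> \<int>" "of_nat n * snd s \<in> \<int>" "d \<in> set (coeffs bl s)"
  shows "of_nat n * d \<in> \<int>"
  using assms
proof (induction bl arbitrary: s)
  case (Cons B bl)
  obtain x y where s: "s = (x, y)" by force
  have xy: "of_nat n * x \<in> \<int>" "of_nat n * y \<in> \<int>" using Cons.prems s by auto
  have comb: "of_nat n * (of_int a * x + of_int b * y + of_int c) \<in> \<int>" for a b c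
  proof -
    have "of_nat n * (of_int a * x + of_int b * y + of_int c)
      = of_int a * (of_nat n * x) + of_int b * (of_nat n * y) + of_nat n * of_int c"
      by (simp add: algebra_simps)
    then show ?thesis using xy by simp
  qed
  have "of_nat n * fst (next_state B s) \<in> \<int> \<and> of_nat n * snd (next_state B s) \<in> \<int>"
  proof (cases B)
    case (Singular k)
    then show ?thesis using s comb[of "int k" 1 0] xy by simp
  next
    case (Regular m)
    then show ?thesis using s comb[of 1 1 "1 - int m"] by (simp add: algebra_simps)
  qed
  moreover have "of_nat n * block_coeff B s l \<in> \<int>" for l
    using comb[of 1 0 1] comb[of "int l" 1 1] comb[of 1 1 "2 - int l"] s
    by (cases B) (auto simp: algebra_simps)
  ultimately show ?case using Cons by auto
next
  case Nil
  then show ?case by (auto simp: distrib_left)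
qed

lemma LEAST_integral_multiple:
  fixes A B :: nat
  assumes "A > 0"
  shows "(LEAST n. n > 0 \<and> rat_of_nat n * (of_nat B / of_nat A) \<in> \<int>) = A div gcd A B"
proof -
  define a where "a = A div gcd A B"
  define b where "b = B div gcd A B"
  have cop: "coprime a b" unfolding a_def b_def using assms by (intro div_gcd_coprime) auto
  have A: "A = gcd A B * a" "B = gcd A B * b" by (simp_all add: a_def b_def)
  have g: "gcd A B > 0" using assms by simp
  have a: "a > 0" using A assms by (cases "a = 0") auto
  have "of_nat B / of_nat A = (of_nat b / of_nat a :: rat)"
    using g arg_cong[OF A(1), of rat_of_nat] arg_cong[OF A(2), of rat_of_nat]
    by (metis mult_divide_mult_cancel_left of_nat_0_less_iff of_nat_mult less_irrefl)
  moreover have "rat_of_nat n * (of_nat b / of_nat a) \<in> \<int> \<longleftrightarrow> a dvd n" for n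
  proof
    assume "rat_of_nat n * (of_nat b / of_nat a) \<in> \<int>"
    then obtain z where "rat_of_nat n * (of_nat b / of_nat a) = of_int z" by (auto elim: Ints_cases)
    then have "rat_of_nat n * of_nat b = of_int z * of_nat a" using a by (simp add: field_simps)
    then have "of_int (int (n * b)) = (of_int (z * int a) :: rat)" by simp
    then have "int (n * b) = z * int a" using of_int_eq_iff by blast
    then have "a dvd n * b" by (metis dvd_triv_right int_dvd_int_iff)
    then show "a dvd n" using cop by (simp add: coprime_dvd_mult_left_iff)
  next
    assume "a dvd n"
    then obtain c where "n = a * c" by blast
    then have "rat_of_nat n * (of_nat b / of_nat a) = of_int (int (c * b))" using a by simp
    then show "rat_of_nat n * (of_nat b / of_nat a) \<in> \<int>" by (metis Ints_of_int)
  qed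
  ultimately show ?thesis unfolding a_def[symmetric] using a
    by (intro Least_equality) (auto dest: dvd_imp_le)
qed

section \<open>Coordinates of the first Chern class\<close>

context kato_cohomology
begin

lemma ip_curves:
  assumes "i < length e" "j < length e"
  shows "ip (D j) (D i) = of_bool (edge_target e j = i) + of_bool (edge_target e i = j)
           - of_bool (i = j) * of_nat (e ! i)"
  using assms curve_self_int[of i] curve_int[of j i]
  by (cases "i = j") (auto simp: self_int_def nodal_def edges_def)

lemma ip_K: "i < length e \<Longrightarrow> ip K (D i) = of_nat (e ! i) - 2"
  using adjunction[of i] curve_self_int[of i]
  by (auto simp: self_int_def arith_genus_def split: if_splits)

lemma ip_zero [simp]: "ip 0 z = 0"
  using ip_scale[of 0 0 z] by simp

lemma ip_sum: "ip (sum g A) z = (\<Sum>a\<in>A. ip (g a) z)"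
  by (induction A rule: infinite_finite_induct) (auto simp: ip_add)

lemma eq_zero_if_orthogonal_to_curves:
  assumes "\<And>i. i < length e \<Longrightarrow> ip v (D i) = 0"
  shows "v = 0"
proof (rule ip_nondegenerate)
  fix y
  have "y \<in> span (D ` {..<length e})" using curves_span by simp
  then show "ip v y = 0"
  proof (induction rule: span_induct_alt)
    case base
    show ?case by (metis ip_sym ip_zero)
  next
    case (step c u y)
    then have "ip u v = 0" "ip y v = 0" using assms ip_sym by auto
    then have "ip (scale c u + y) v = 0" by (simp add: ip_add ip_scale)
    then show ?case using ip_sym by simp
  qed
qed

lemma anticanonical_coordinates:
  assumes "\<And>i. i < length e \<Longrightarrow>
      - of_nat (e ! i) * d i + d (edge_target e i)
      + (\<Sum>j<length e. of_bool (edge_target e j = i) * d j) = 2 - of_nat (e ! i)"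
  shows "- K = (\<Sum>i<length e. scale (d i) (D i))"
proof -
  let ?v = "\<Sum>i<length e. scale (d i) (D i)"
  have "?v + K = 0"
  proof (rule eq_zero_if_orthogonal_to_curves)
    fix i assume i: "i < length e"
    then have t: "edge_target e i < length e"
      unfolding edge_target_def by (intro mod_less_divisor) linarith
    have "ip ?v (D i) = (\<Sum>j<length e. d j * ip (D j) (D i))"
      by (simp add: ip_sum ip_scale)
    also have "\<dots> = (\<Sum>j<length e. of_bool (edge_target e j = i) * d j
        + (if j = edge_target e i then d j else 0) - (if j = i then of_nat (e ! i) * d j else 0))"
      using i by (intro sum.cong) (auto simp: ip_curves algebra_simps)
    also have "\<dots> = 2 - of_nat (e ! i)"
      using i t assms[OF i] by (simp add: sum.distrib sum_subtractf algebra_simps)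
    finally show "ip (?v + K) (D i) = 0" using ip_K[OF i] by (simp add: ip_add)
  qed
  then show ?thesis by (simp add: add_eq_0_iff)
qed

lemma curve_coordinates_unique:
  assumes "(\<Sum>i<length e. scale (a i) (D i)) = (\<Sum>i<length e. scale (b i) (D i))" "i < length e"
  shows "a i = b i"
proof -
  \<comment> \<open>Linear independence concerns the set of curve classes, so coordinates are moved to it along \<open>D\<close>.\<close>
  define u where "u v = (a - b) (inv_into {..<length e} D v)" for v
  have "(\<Sum>v\<in>D ` {..<length e}. scale (u v) v) = (\<Sum>i<length e. scale (u (D i)) (D i))"
    using curves_inj by (simp add: sum.reindex)
  also have "\<dots> = (\<Sum>i<length e. scale (a i) (D i) - scale (b i) (D i))"
    using curves_inj by (intro sum.cong) (auto simp: u_def scale_left_diff_distrib)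
  also have "\<dots> = 0" using assms(1) by (simp add: sum_subtractf)
  finally have "u (D i) = 0"
    using independentD[OF curves_independent, of "D ` {..<length e}" u "D i"] assms(2) by auto
  then show ?thesis using curves_inj assms(2) by (simp add: u_def)
qed

lemma surface_index_eq_LEAST:
  assumes K: "- K = (\<Sum>i<length e. scale (d i) (D i))"
    and nonneg: "\<And>i. i < length e \<Longrightarrow> d i \<ge> 0"
  shows "surface_index scale K D (length e)
    = (LEAST n. n > 0 \<and> (\<forall>i<length e. of_nat n * d i \<in> \<int>))"
proof -
  have "(\<exists>a :: nat \<Rightarrow> nat. scale (of_nat n) (- K) = (\<Sum>i<length e. scale (of_nat (a i)) (D i)))
     \<longleftrightarrow> (\<forall>i<length e. of_nat n * d i \<in> \<int>)" (is "?L \<longleftrightarrow> ?R") for n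
  proof -
    have nK: "scale (of_nat n) (- K) = (\<Sum>i<length e. scale (of_nat n * d i) (D i))"
      by (simp add: K scale_sum_right)
    show ?thesis
    proof
      assume ?L
      then obtain a :: "nat \<Rightarrow> nat" where
        "(\<Sum>i<length e. scale (of_nat n * d i) (D i)) = (\<Sum>i<length e. scale (of_nat (a i)) (D i))"
        using nK by auto
      then have "of_nat n * d i = of_nat (a i)" if "i < length e" for i
        using curve_coordinates_unique[of "\<lambda>i. of_nat n * d i" "\<lambda>i. of_nat (a i)"] that by blast
      then show ?R by (metis Ints_of_nat)
    next
      assume R: ?R
      have "\<exists>c::nat. of_nat n * d i = of_nat c" if "i < length e" for i
        using R nonneg that
        by (metis Ints_cases of_int_0_le_iff of_int_of_nat_eq mult_nonneg_nonneg of_nat_0_le_iff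
            nonneg_int_cases)
      then obtain a :: "nat \<Rightarrow> nat" where "\<And>i. i < length e \<Longrightarrow> of_nat n * d i = of_nat (a i)"
        by metis
      then show ?L unfolding nK by (intro exI[of _ a] sum.cong) auto
    qed
  qed
  then show ?thesis by (simp add: surface_index_def)
qed

text \<open>
  The walk closes up for the fixed point of \<open>x \<mapsto> a x - b\<close>, and the index is the reduced denominator
  of that fixed point, since integrality and nonnegativity of all coefficients reduce to it.
\<close>
lemma surface_index_of_blocks:
  fixes a b :: nat
  assumes e: "e = word bl" and proper: "proper bl" and last: "bl \<noteq> []" "last bl = Regular m"
    and a: "a > 1"
    and affine: "\<And>x. fst (fold next_state bl (x, -1)) = of_nat a * x - of_nat b"
  shows "surface_index scale K D (length e) = (a - 1) div gcd (a - 1) b"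
proof -
  define x :: rat where "x = of_nat b / of_nat (a - 1)"
  define d where "d i = coeffs bl (x, -1) ! i" for i
  have fixed: "fst (fold next_state bl (x, -1)) = x"
    using a by (simp add: affine x_def of_nat_diff field_simps)
  have x: "x \<ge> 0" by (simp add: x_def)
  have mem: "d i \<in> set (coeffs bl (x, -1))" if "i < length e" for i
    using that by (simp add: d_def e coeffs_append)
  have coords: "- K = (\<Sum>i<length e. scale (d i) (D i))"
    using coeffs_solve[OF proper last fixed]
    by (intro anticanonical_coordinates) (simp add: d_def e)
  have "d i \<ge> 0" if "i < length e" for i
    using coeffs_nonneg[OF proper _ _ _ mem[OF that]] fixed x by simp
  then have "surface_index scale K D (length e)
     = (LEAST n. n > 0 \<and> (\<forall>i<length e. of_nat n * d i \<in> \<int>))"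
    by (intro surface_index_eq_LEAST[OF coords])
  also have "\<dots> = (LEAST n. n > 0 \<and> of_nat n * x \<in> \<int>)"
  proof -
    have "(\<forall>i<length e. of_nat n * d i \<in> \<int>) \<longleftrightarrow> of_nat n * x \<in> \<int>" for n
    proof
      assume *: "\<forall>i<length e. of_nat n * d i \<in> \<int>"
      have "length e > 0" using last proper e by (cases bl) auto
      then have "of_nat n * (x + 1) \<in> \<int>"
        using * hd_coeffs[OF proper, of "(x, -1)"] by (auto simp: d_def)
      then have "of_nat n * (x + 1) - of_nat n \<in> \<int>" by simp
      then show "of_nat n * x \<in> \<int>" by (simp add: algebra_simps)
    next
      assume "of_nat n * x \<in> \<int>"
      then show "\<forall>i<length e. of_nat n * d i \<in> \<int>"
        using coeffs_integral[of n "(x, -1)"] mem by auto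
    qed
    then show ?thesis by simp
  qed
  also have "\<dots> = (a - 1) div gcd (a - 1) b"
    unfolding x_def using a by (intro LEAST_integral_multiple) simp
  finally show ?thesis .
qed

end

section \<open>Simple sequences and continuants\<close>

definition simple_blocks :: "(nat \<Rightarrow> nat) \<Rightarrow> nat \<Rightarrow> nat \<Rightarrow> block list" where
  "simple_blocks k p m = map (\<lambda>i. Singular (k i)) [0..<p] @ [Regular m]"

lemma word_simple_blocks:
  assumes "\<And>i. i < p \<Longrightarrow> k i \<ge> 1"
  shows "word (simple_blocks k p m) = simple_seq k p m"
proof -
  have s: "block_word (Singular c) = s_seq c" if "c \<ge> 1" for c
    using that by (auto simp: block_word_def s_seq_def nth_Cons' intro!: nth_equalityI)
  have r: "block_word (Regular m) = r_seq m"
    by (auto simp: block_word_def r_seq_def intro!: nth_equalityI)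
  have "map (\<lambda>i. block_word (Singular (k i))) [0..<p] = map (\<lambda>i. s_seq (k i)) [0..<p]"
    using assms s by (intro map_cong) auto
  then have "concat (map (\<lambda>i. block_word (Singular (k i))) [0..<p])
      = concat (map (\<lambda>i. s_seq (k i)) [0..<p])" by (rule arg_cong)
  then show ?thesis by (simp only: simple_blocks_def simple_seq_def word_def r comp_def
      map_append map_map concat_append list.map concat.simps append_Nil2)
qed

text \<open>
  The recursions say that \<open>P\<close> grows by \<open>X_n f_(n-1) = f_n - f_(n-2)\<close>, which telescopes.
\<close>
lemma poly_P_eq: "poly_P X (Suc n) + 1 = poly_f X (Suc n) + poly_f X n"
  by (induction n) auto

text \<open>
  Both components are values of the continuant recursion, started from \<open>(x, -1)\<close>. The coefficient
  of \<open>x\<close> sees all the \<open>k i\<close>; the constant part starts one step later, hence the shifted arguments.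
  For \<open>q = 0\<close> the continuant of \<open>-1\<close> letters that occurs in \<open>y\<close> is \<open>0\<close>.
\<close>
lemma fold_singular:
  "fold next_state (map (\<lambda>i. Singular (k i)) [0..<Suc q]) (x, -1)
   = (of_nat (poly_f k (Suc q)) * x - of_nat (poly_f (\<lambda>i. k (Suc i)) q),
      of_nat (poly_f k q) * x - (if q = 0 then 0 else of_nat (poly_f (\<lambda>i. k (Suc i)) (q - 1))))"
proof (induction q)
  case (Suc q)
  then show ?case by (cases q) (simp_all add: algebra_simps)
qed simp

lemma fold_simple_blocks:
  assumes "p \<ge> 1"
  shows "fold next_state (simple_blocks k p m) (x, -1)
    = ((of_nat (poly_P k p) + 1) * x - of_nat (poly_P (\<lambda>i. k (Suc i)) (p - 1) + m), -1)"
proof -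
  obtain q where p: "p = Suc q" using assms by (cases p) auto
  have P: "rat_of_nat (poly_P k p) + 1 = of_nat (poly_f k (Suc q)) + of_nat (poly_f k q)"
    using poly_P_eq[of k q] unfolding p by (metis of_nat_1 of_nat_add)
  have Q: "rat_of_nat (poly_P (\<lambda>i. k (Suc i)) q) + 1 = of_nat (poly_f (\<lambda>i. k (Suc i)) q)
     + (if q = 0 then 0 else of_nat (poly_f (\<lambda>i. k (Suc i)) (q - 1)))"
    using poly_P_eq[of "\<lambda>i. k (Suc i)" "q - 1"] by (cases q) (auto simp flip: of_nat_add of_nat_Suc)
  show ?thesis
    unfolding P simple_blocks_def
    using Q fold_singular[of k q x] by (simp add: p algebra_simps del: upt_Suc)
qed

lemma fold_dloussky:
  assumes "\<And>f. f \<in> {1..N} \<Longrightarrow> p f \<ge> 1"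
  shows "fold next_state (concat (map (\<lambda>f. simple_blocks (k f) (p f) (m f)) [1..<Suc N])) (x, -1)
    = (of_nat (\<Prod>f=1..N. poly_P (k f) (p f) + 1) * x
       - of_nat (\<Sum>h=1..N. (poly_P (\<lambda>i. k h (Suc i)) (p h - 1) + m h)
                            * (\<Prod>f=h+1..N. poly_P (k f) (p f) + 1)), -1)"
  using assms
proof (induction N)
  case (Suc N)
  let ?P = "\<lambda>f. poly_P (k f) (p f) + 1" and ?Q = "\<lambda>h. poly_P (\<lambda>i. k h (Suc i)) (p h - 1) + m h"
  have "(\<Sum>h=1..N. ?Q h * (\<Prod>f=h+1..Suc N. ?P f)) = (\<Sum>h=1..N. ?Q h * (\<Prod>f=h+1..N. ?P f)) * ?P (Suc N)"
    unfolding sum_distrib_right by (intro sum.cong) (auto simp: prod.nat_ivl_Suc' algebra_simps)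
  then have B: "(\<Sum>h=1..Suc N. ?Q h * (\<Prod>f=h+1..Suc N. ?P f))
     = (\<Sum>h=1..N. ?Q h * (\<Prod>f=h+1..N. ?P f)) * ?P (Suc N) + ?Q (Suc N)"
    by simp
  have A: "(\<Prod>f=1..Suc N. ?P f) = (\<Prod>f=1..N. ?P f) * ?P (Suc N)"
    by (simp add: prod.nat_ivl_Suc' mult.commute)
  have IH: "fold next_state (concat (map (\<lambda>f. simple_blocks (k f) (p f) (m f)) [1..<Suc N])) (x, -1)
    = (of_nat (\<Prod>f=1..N. ?P f) * x - of_nat (\<Sum>h=1..N. ?Q h * (\<Prod>f=h+1..N. ?P f)), -1)"
    using Suc by simp
  have "[1..<Suc (Suc N)] = [1..<Suc N] @ [Suc N]" by simp
  then show ?case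
    unfolding A B using Suc.prems
    by (simp only: map_append concat_append fold_append comp_apply IH)
       (simp add: fold_simple_blocks algebra_simps)
qed simp

theorem theorem4p1:
  fixes scale :: "rat \<Rightarrow> 'h::ab_group_add \<Rightarrow> 'h"
    and ip :: "'h \<Rightarrow> 'h \<Rightarrow> rat"
    and K :: 'h
    and D :: "nat \<Rightarrow> 'h"
    and e :: "nat list"
    and N :: nat
    and p m :: "nat \<Rightarrow> nat"
    and k :: "nat \<Rightarrow> nat \<Rightarrow> nat"
  assumes surface: "kato_cohomology scale ip K D e"
    and dloussky: "e = dloussky_seq N p k m"
    and N: "N \<ge> 1"
    and p: "\<And>f. f \<in> {1..N} \<Longrightarrow> p f \<ge> 1"
    and k: "\<And>f i. f \<in> {1..N} \<Longrightarrow> i < p f \<Longrightarrow> k f i \<ge> 1"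
    and m: "\<And>f. f \<in> {1..N} \<Longrightarrow> m f \<ge> 1"
  shows "let P = (\<lambda>f. poly_P (k f) (p f));
             Q = (\<lambda>f. poly_P (\<lambda>i. k f (Suc i)) (p f - 1) + m f);
             A = (\<Prod>f=1..N. P f + 1) - 1;
             B = (\<Sum>h=1..N. Q h * (\<Prod>f=h+1..N. P f + 1))
         in rat_of_nat (surface_index scale K D (length e)) = rat_of_nat A / rat_of_nat (gcd A B)"
proof -
  interpret kato_cohomology scale ip K D e by (rule surface)
  let ?P = "\<lambda>f. poly_P (k f) (p f) + 1"
  define a where "a = (\<Prod>f=1..N. ?P f)"
  define b where "b = (\<Sum>h=1..N. (poly_P (\<lambda>i. k h (Suc i)) (p h - 1) + m h) * (\<Prod>f=h+1..N. ?P f))"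
  define bl where "bl = concat (map (\<lambda>f. simple_blocks (k f) (p f) (m f)) [1..<Suc N])"
  have e: "e = word bl"
  proof -
    have "word bl = concat (map (\<lambda>f. word (simple_blocks (k f) (p f) (m f))) [1..<Suc N])"
      unfolding bl_def by (induction N) auto
    also have "map (\<lambda>f. word (simple_blocks (k f) (p f) (m f))) [1..<Suc N]
        = map (\<lambda>f. simple_seq (k f) (p f) (m f)) [1..<Suc N]"
      using k by (intro map_cong) (auto simp: word_simple_blocks)
    finally show ?thesis by (simp add: dloussky dloussky_seq_def)
  qed
  have proper: "proper bl"
    using k m by (auto simp: proper_def bl_def simple_blocks_def simp del: upt_Suc)
  have last: "bl \<noteq> []" "last bl = Regular (m N)"
    using N by (auto simp: bl_def simple_blocks_def)
  \<comment> \<open>The map \<open>x \<mapsto> a x - b\<close> has a unique fixed point because every factor of \<open>a\<close> is at least \<open>2\<close>.\<close>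
  have "?P f \<ge> 2" if f: "f \<in> {1..N}" for f
  proof -
    obtain q where q: "p f = Suc q" using p[OF f] by (cases "p f") auto
    have pos: "poly_f (k f) n \<ge> 1" if "n \<le> p f" for n
      using that k[OF f] by (induction "k f" n rule: poly_f.induct) (auto simp: Suc_le_eq)
    then show ?thesis using poly_P_eq[of "k f" q] pos[of q] pos[of "Suc q"] unfolding q by linarith
  qed
  then have "(\<Prod>f=1..N. 2) \<le> a" unfolding a_def by (intro prod_mono) simp
  then have "2 ^ N \<le> a" by simp
  moreover have "(2::nat) ^ N > 1" using N by (intro one_less_power) simp_all
  ultimately have a: "a > 1" by linarith
  have "surface_index scale K D (length e) = (a - 1) div gcd (a - 1) b"
    using surface_index_of_blocks[OF e proper last a] fold_dloussky[of N p k m] p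
    by (simp only: bl_def[symmetric] a_def[symmetric] b_def[symmetric] fst_conv)
  then have "rat_of_nat (surface_index scale K D (length e))
      = rat_of_nat (a - 1) / rat_of_nat (gcd (a - 1) b)"
    by (simp only: of_nat_of_nat_div gcd_dvd1)
  then show ?thesis unfolding Let_def a_def[symmetric] b_def[symmetric] .
qed

end
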